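(* Let $k \geq 2$ and let $H = K_{k,k,\dots,k}$ be a complete multipartite graph with at least two parts, all of size $k$. Then $q(H) = 2$ and $MB(H) = k$.
   Context: All graphs are finite and simple. For a graph $G$ on $n$ vertices, $\mathcal{S}(G)$ is the set of real symmetric $n\times n$ matrices $A=[a_{ij}]$ (indexed by the vertices) such that for $i\neq j$, $a_{ij}\neq 0$ if and only if $ij$ is an edge of $G$; the diagonal entries are arbitrary. $q(A)$ is the number of distinct eigenvalues of $A$, and $q(G)=\min\{q(A): A\in\mathcal{S}(G)\}$. A graph $G$ on $n$ vertices achieves the multiplicity bipartition $[n-k,k]$, where $1\le k\leq\lfloor n/2\rfloor$, if some $A\in\mathcal{S}(G)$ has exactly two distinct eigenvalues, with multiplicities $n-k$ and $k$. For a graph $G$ with $q(G)=2$, $MB(G)$ is the least integer $k\leq \lfloor n/2\rfloor$ such that $G$ achieves $[n-k,k]$. *)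

theory Defs
  imports "HOL-Analysis.Analysis" "HOL-Library.Disjoint_Sets"
begin

(* The vertex set of a graph is an arbitrary finite type 'v, so a graph on n = CARD('v) vertices
   is an adjacency relation on 'v and its matrices have type real^'v^'v. *)
type_synonym 'v graph = "'v \<Rightarrow> 'v \<Rightarrow> bool"

definition simple_graph :: "'v graph \<Rightarrow> bool" where
  "simple_graph G \<longleftrightarrow> symp G \<and> irreflp G"

definition complete_multipartite :: "'v graph \<Rightarrow> 'v set set \<Rightarrow> bool" where
  "complete_multipartite G P \<longleftrightarrow>
     partition_on UNIV P \<and> (\<forall>u v. G u v \<longleftrightarrow> \<not> (\<exists>X\<in>P. u \<in> X \<and> v \<in> X))"

lemma complete_multipartite_simple:
  assumes "complete_multipartite G P"
  shows "simple_graph G"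
proof -
  have cover: "\<Union>P = UNIV"
    and adj: "\<And>u v. G u v \<longleftrightarrow> \<not> (\<exists>X\<in>P. u \<in> X \<and> v \<in> X)"
    using assms by (simp_all add: complete_multipartite_def partition_on_def)
  have "symp G"
    by (rule sympI) (auto simp: adj)
  moreover have "\<not> G u u" for u
    using adj[of u u] UnionE[of u P] cover by auto
  ultimately show ?thesis
    by (simp add: simple_graph_def irreflp_on_def)
qed

definition graph_matrices :: "'v::finite graph \<Rightarrow> (real^'v^'v) set" where
  "graph_matrices G =
     {A. transpose A = A \<and> (\<forall>i j. i \<noteq> j \<longrightarrow> (A $ i $ j \<noteq> 0 \<longleftrightarrow> G i j))}"

definition eigenspace :: "real^'v^'v \<Rightarrow> real \<Rightarrow> (real^'v::finite) set" where
  "eigenspace A c = {x. A *v x = c *\<^sub>R x}"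

definition eigenvalues :: "real^'v::finite^'v \<Rightarrow> real set" where
  "eigenvalues A = {c. \<exists>x. x \<noteq> 0 \<and> A *v x = c *\<^sub>R x}"

(* For real symmetric matrices, the only ones considered here, the geometric and the algebraic
   multiplicity of an eigenvalue coincide. *)
definition eig_mult :: "real^'v::finite^'v \<Rightarrow> real \<Rightarrow> nat" where
  "eig_mult A c = dim (eigenspace A c)"

lemma finite_eigenvalues:
  fixes A :: "real^'v::finite^'v"
  assumes "transpose A = A"
  shows "finite (eigenvalues A)"
proof -
  have "\<forall>c. \<exists>x. c \<in> eigenvalues A \<longrightarrow> x \<noteq> 0 \<and> A *v x = c *\<^sub>R x"
    unfolding eigenvalues_def by blast
  then obtain f where f: "\<And>c. c \<in> eigenvalues A \<Longrightarrow> f c \<noteq> 0 \<and> A *v f c = c *\<^sub>R f c"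
    using choice[of "\<lambda>c x. c \<in> eigenvalues A \<longrightarrow> x \<noteq> 0 \<and> A *v x = c *\<^sub>R x"] by blast
  have orth: "f c \<bullet> f d = 0" if "c \<in> eigenvalues A" "d \<in> eigenvalues A" "c \<noteq> d" for c d
  proof -
    have "(A *v f c) \<bullet> f d = f c \<bullet> (A *v f d)"
      by (metis assms dot_lmul_matrix transpose_matrix_vector)
    then have "c * (f c \<bullet> f d) = d * (f c \<bullet> f d)"
      using f[OF that(1)] f[OF that(2)] by (simp only: inner_scaleR_left inner_scaleR_right)
    then show ?thesis
      using that(3) by simp
  qed
  have "inj_on f (eigenvalues A)"
  proof (rule inj_onI, rule ccontr)
    fix c d assume "c \<in> eigenvalues A" "d \<in> eigenvalues A" "f c = f d" "c \<noteq> d"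
    then show False
      using orth[of c d] f[of d] by simp
  qed
  moreover have "independent (f ` eigenvalues A)"
  proof (rule pairwise_orthogonal_independent)
    show "pairwise orthogonal (f ` eigenvalues A)"
      unfolding pairwise_def orthogonal_def using orth by blast
    show "0 \<notin> f ` eigenvalues A"
      using f by auto
  qed
  then have "finite (f ` eigenvalues A)"
    using independent_bound by blast
  ultimately show ?thesis
    using finite_image_iff by blast
qed

(* q(A); the cardinality is meaningful on graph_matrices G by finite_eigenvalues. *)
definition num_eigenvalues :: "real^'v::finite^'v \<Rightarrow> nat" where
  "num_eigenvalues A = card (eigenvalues A)"

(* q(G) *)
definition q_graph :: "'v::finite graph \<Rightarrow> nat" where
  "q_graph G = (LEAST m. \<exists>A\<in>graph_matrices G. num_eigenvalues A = m)"

(* The multiplicity bipartition [n - k, k]. *)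
definition achieves_bipartition :: "'v::finite graph \<Rightarrow> nat \<Rightarrow> bool" where
  "achieves_bipartition G k \<longleftrightarrow>
     1 \<le> k \<and> k \<le> CARD('v) div 2 \<and>
     (\<exists>A\<in>graph_matrices G. \<exists>a b. a \<noteq> b \<and> eigenvalues A = {a, b} \<and>
        eig_mult A a = CARD('v) - k \<and> eig_mult A b = k)"

(* Intended for q_graph G = 2, where some bipartition is achieved. *)
definition MB :: "'v::finite graph \<Rightarrow> nat" where
  "MB G = (LEAST k. achieves_bipartition G k)"

end

(* A symmetric matrix with two eigenvalues 0 and c is c times an orthogonal projection. For the upper
   bound give the vertices of each part an orthonormal basis of R^k as labels; the Gram matrix of all
   labels has eigenvalues 0 and |P|, the latter with multiplicity k, and it has the right zero pattern
   as soon as labels from different parts are never orthogonal. Such bases are chosen one part at a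
   time as the rows of a Householder reflection along (1, t, ..., t^(k-1)), where finitely many
   polynomials in t have to be non-zero. For the lower bound, if A has eigenvalues a and b only, then
   (A - a)(A - a) = (b - a)(A - a), so the columns of A - a belonging to one part are pairwise
   orthogonal, and they are non-zero vectors in the b-eigenspace. Finally q >= 2 because a symmetric
   matrix whose Rayleigh quotient has equal maximum and minimum is scalar. *)
theory Submission
  imports Defs "HOL-Computational_Algebra.Polynomial"
begin

section \<open>Orthonormal bases with no orthogonal pair across bases\<close>

text \<open>Functions on \<open>nat\<close>, read below \<open>k\<close>, stand for vectors of R^k.
  For the reflection along v = (1, t, ..., t^(k-1)), each forbidden event "row j is orthogonal to f"
  is a non-trivial polynomial equation in t, so all but finitely many t are good.\<close>

lemma householder_avoiding:
  fixes F :: "(nat \<Rightarrow> real) set"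
  assumes k: "k \<ge> 2" and fin: "finite F" and nz: "\<And>f. f \<in> F \<Longrightarrow> \<exists>i<k. f i \<noteq> 0"
  obtains Q :: "nat \<Rightarrow> nat \<Rightarrow> real" where
    "\<And>i j. Q i j = Q j i"
    "\<And>i j. i < k \<Longrightarrow> j < k \<Longrightarrow> (\<Sum>l<k. Q i l * Q j l) = (if i = j then 1 else 0)"
    "\<And>f j. f \<in> F \<Longrightarrow> j < k \<Longrightarrow> (\<Sum>l<k. Q j l * f l) \<noteq> 0"
proof -
  \<comment> \<open>At t this is entry j of the reflected \<open>f\<close>, multiplied by the
    squared length of v to clear the denominator.\<close>
  define p :: "(nat \<Rightarrow> real) \<Rightarrow> nat \<Rightarrow> real poly" where
    "p f j = (\<Sum>i<k. monom (f j) (2 * i)) - (\<Sum>i<k. monom (2 * f i) (i + j))" for f j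
  have p_nz: "p f j \<noteq> 0" if f: "f \<in> F" and j: "j < k" for f j
  proof (cases "f j = 0")
    \<comment> \<open>The first sum vanishes and the exponents \<open>i + j\<close> are distinct, so
      any non-zero \<open>f i\<close> leaves a non-zero coefficient.\<close>
    case True
    obtain i where i: "i < k" "f i \<noteq> 0"
      using nz[OF f] by blast
    have "coeff (p f j) (i + j) = - 2 * f i"
      using True i by (simp add: p_def coeff_sum sum.delta)
    then show ?thesis
      using i by auto
  next
    case False
    \<comment> \<open>The exponent 2 * l of the first sum is chosen outside the range {j..<j + k} of the second.\<close>
    define l where "l = (if j = k - 1 then 0 else k - 1)"
    have l: "l < k" "\<And>i. i < k \<Longrightarrow> i + j \<noteq> 2 * l"
      using k j by (auto simp: l_def split: if_splits)
    have "(\<Sum>i<k. coeff (monom (2 * f i) (i + j)) (2 * l)) = 0"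
      using l by (intro sum.neutral) auto
    then have "coeff (p f j) (2 * l) = f j"
      using l(1) by (simp add: p_def coeff_sum sum.delta)
    then show ?thesis
      using False by auto
  qed
  have "finite (\<Union>f\<in>F. \<Union>j<k. {t. poly (p f j) t = 0})"
    using fin p_nz by (auto intro!: poly_roots_finite)
  then obtain t where t: "\<And>f j. f \<in> F \<Longrightarrow> j < k \<Longrightarrow> poly (p f j) t \<noteq> 0"
    using ex_new_if_finite[OF infinite_UNIV_char_0] by fastforce
  define N where "N = (\<Sum>i<k. t ^ i * t ^ i)"
  \<comment> \<open>The term of index 0 is 1 for every t, so the division by \<open>N\<close> below
    is harmless.\<close>
  have "0 < t ^ 0 * t ^ 0" by simp
  also have "\<dots> \<le> N"
    unfolding N_def using k by (intro member_le_sum) auto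
  finally have N: "N > 0" .
  define Q :: "nat \<Rightarrow> nat \<Rightarrow> real" where
    "Q i j = (if i = j then 1 else 0) - 2 * t ^ i * t ^ j / N" for i j
  have Qsum: "(\<Sum>l<k. Q j l * f l) = f j - 2 * t ^ j / N * (\<Sum>l<k. t ^ l * f l)"
    if "j < k" for f j
  proof -
    have "(\<Sum>l<k. Q j l * f l) = (\<Sum>l<k. (if j = l then f l else 0) - 2 * t ^ j / N * (t ^ l * f l))"
      by (intro sum.cong) (auto simp: Q_def algebra_simps)
    then show ?thesis
      using that by (simp add: sum_subtractf sum_distrib_left sum.delta)
  qed
  show thesis
  proof
    show "Q i j = Q j i" for i j
      by (simp add: Q_def)
    show "(\<Sum>l<k. Q i l * Q j l) = (if i = j then 1 else 0)" if "i < k" "j < k" for i j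
    proof -
      \<comment> \<open>A reflection sends its own vector v to -v; this cancels the rank-one terms
        in the product of rows i and j.\<close>
      have "(\<Sum>l<k. Q j l * t ^ l) = - (t ^ j)"
        using Qsum[OF that(2), of "\<lambda>l. t ^ l"] N by (simp flip: N_def)
      then have "(\<Sum>l<k. t ^ l * Q j l) = - (t ^ j)"
        by (simp add: mult.commute)
      then show ?thesis
        using Qsum[OF that(1), of "Q j"] by (simp add: Q_def)
    qed
    show "(\<Sum>l<k. Q j l * f l) \<noteq> 0" if "f \<in> F" "j < k" for f j
    proof -
      have "poly (p f j) t = f j * N - 2 * t ^ j * (\<Sum>l<k. t ^ l * f l)"
        by (simp add: p_def N_def poly_sum poly_monom sum_distrib_left power_add mult_ac
            power_mult power2_eq_square power_mult_distrib)
      also have "\<dots> = N * (\<Sum>l<k. Q j l * f l)"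
        using Qsum[OF that(2)] N by (simp add: field_simps)
      finally show ?thesis
        using t[OF that] by auto
    qed
  qed
qed

text \<open>Induction on the index set: the rows of all matrices chosen so far form a finite set of
  unit vectors, and a reflection avoiding this set serves the new index. Symmetry is recorded
  because it later turns sums over rows into sums over columns.\<close>

lemma orthogonal_family_nowhere_zero_products:
  assumes k: "k \<ge> 2" and "finite I"
  shows "\<exists>Q :: 'a \<Rightarrow> nat \<Rightarrow> nat \<Rightarrow> real.
    (\<forall>x\<in>I. \<forall>i j. Q x i j = Q x j i) \<and>
    (\<forall>x\<in>I. \<forall>i<k. \<forall>j<k. (\<Sum>l<k. Q x i l * Q x j l) = (if i = j then 1 else 0)) \<and>
    (\<forall>x\<in>I. \<forall>y\<in>I. x \<noteq> y \<longrightarrow> (\<forall>i<k. \<forall>j<k. (\<Sum>l<k. Q x i l * Q y j l) \<noteq> 0))"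
  using \<open>finite I\<close>
proof induction
  case empty
  show ?case by simp
next
  case (insert z I)
  obtain Q :: "'a \<Rightarrow> nat \<Rightarrow> nat \<Rightarrow> real" where
    sym: "\<forall>x\<in>I. \<forall>i j. Q x i j = Q x j i" and
    orth: "\<forall>x\<in>I. \<forall>i<k. \<forall>j<k. (\<Sum>l<k. Q x i l * Q x j l) = (if i = j then 1 else 0)" and
    nz: "\<forall>x\<in>I. \<forall>y\<in>I. x \<noteq> y \<longrightarrow> (\<forall>i<k. \<forall>j<k. (\<Sum>l<k. Q x i l * Q y j l) \<noteq> 0)"
    using insert.IH by (elim exE conjE) (rule that)
  note sym = sym[rule_format] and orth = orth[rule_format] and nz = nz[rule_format]
  define F where "F = (\<lambda>(x, i). Q x i) ` (I \<times> {..<k})"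
  have finF: "finite F"
    using insert.hyps by (simp add: F_def)
  have nzF: "\<exists>i<k. f i \<noteq> 0" if "f \<in> F" for f
  proof (rule ccontr)
    assume "\<not> ?thesis"
    then have "(\<Sum>l<k. f l * f l) = 0" by simp
    then show False
      using that orth by (auto simp: F_def)
  qed
  obtain R :: "nat \<Rightarrow> nat \<Rightarrow> real" where
    R: "\<And>i j. R i j = R j i"
      "\<And>i j. i < k \<Longrightarrow> j < k \<Longrightarrow> (\<Sum>l<k. R i l * R j l) = (if i = j then 1 else 0)"
      "\<And>f j. f \<in> F \<Longrightarrow> j < k \<Longrightarrow> (\<Sum>l<k. R j l * f l) \<noteq> 0"
    by (rule householder_avoiding[OF k finF nzF]) (assumption, rule that)
  \<comment> \<open>The new index may be either member of the pair, so both orders of the product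
    are prepared.\<close>
  have R3: "(\<Sum>l<k. R i l * Q y j l) \<noteq> 0" if "y \<in> I" "i < k" "j < k" for y i j
    using R(3)[of "Q y j" i] that by (force simp: F_def)
  then have R4: "(\<Sum>l<k. Q y j l * R i l) \<noteq> 0" if "y \<in> I" "i < k" "j < k" for y i j
    using that by (simp add: mult.commute)
  show ?case
    using insert.hyps sym orth nz R(1,2) R3 R4
    by (intro exI[of _ "Q(z := R)"]) (auto simp: fun_upd_def)
qed

section \<open>Extreme eigenvalues of symmetric matrices\<close>

lemma inner_symmetric_matrix:
  fixes A :: "real^'n^'n"
  assumes "transpose A = A"
  shows "(A *v x) \<bullet> y = x \<bullet> (A *v y)"
  by (metis assms dot_lmul_matrix transpose_matrix_vector)

text \<open>A zero of a non-negative form is a minimum, so its gradient 2 A x vanishes; concretely,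
  a small step from x along -A x would make the form negative.\<close>

lemma positive_semidefinite_null:
  fixes A :: "real^'n^'n"
  assumes sym: "transpose A = A" and psd: "\<And>y. y \<bullet> (A *v y) \<ge> 0" and x: "x \<bullet> (A *v x) = 0"
  shows "A *v x = 0"
proof (rule ccontr)
  define z where "z = A *v x"
  assume "A *v x \<noteq> 0"
  then have z: "z \<bullet> z > 0" by (simp add: z_def)
  define m where "m = z \<bullet> (A *v z)"
  have m: "m \<ge> 0" by (simp add: m_def psd)
  have *: "0 \<le> t * (t * m - 2 * (z \<bullet> z))" for t
  proof -
    have "x \<bullet> (A *v z) = z \<bullet> z"
      using inner_symmetric_matrix[OF sym, of x z] by (simp add: z_def)
    then have "(x - t *\<^sub>R z) \<bullet> (A *v (x - t *\<^sub>R z)) = t * (t * m - 2 * (z \<bullet> z))"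
      using x by (simp add: matrix_vector_mult_diff_distrib matrix_vector_mult_scaleR
          inner_diff_left inner_diff_right m_def algebra_simps flip: z_def)
    then show ?thesis
      using psd[of "x - t *\<^sub>R z"] by simp
  qed
  \<comment> \<open>Small enough that the quadratic term cannot outweigh the linear one; the +1
    covers \<open>m = 0\<close>.\<close>
  define t where "t = (z \<bullet> z) / (m + 1)"
  have t: "t > 0" using z m by (simp add: t_def)
  have "t * m \<le> z \<bullet> z"
    using z m by (simp add: t_def field_simps)
  then have "t * m - 2 * (z \<bullet> z) < 0" using z by linarith
  then show False
    using *[of t] t by (simp add: zero_le_mult_iff)
qed

lemma transpose_mat_diff:
  fixes A :: "real^'n^'n"
  assumes "transpose A = A"
  shows "transpose (mat c - A) = mat c - A"
  using assms by (simp add: transpose_def mat_def vec_eq_iff)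

lemma mat_diff_vector_mult:
  fixes A :: "real^'n^'n"
  shows "(mat c - A) *v x = c *\<^sub>R x - A *v x"
proof -
  have "mat c *v x = c *\<^sub>R x"
    by (simp add: vec_eq_iff matrix_vector_mult_def mat_def if_distrib[of "\<lambda>a. a * _"] sum.delta cong: if_cong)
  then show ?thesis
    by (simp add: matrix_vector_mult_diff_rdistrib)
qed

text \<open>The quadratic form attains a maximum c on the compact unit sphere. Then
  \<open>mat c - A\<close> is positive semidefinite with form 0 at the maximiser, which is therefore
  an eigenvector.\<close>

lemma max_eigenvalue:
  fixes A :: "real^'v::finite^'v"
  assumes sym: "transpose A = A"
  obtains c where "c \<in> eigenvalues A" "\<And>y. y \<bullet> (A *v y) \<le> c * (y \<bullet> y)"
proof -
  have cont: "continuous_on (sphere 0 1) (\<lambda>x. x \<bullet> (A *v x))"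
    by (intro continuous_on_inner continuous_on_id linear_continuous_on matrix_vector_mul_bounded_linear)
  have "sphere (0 :: real^'v) 1 \<noteq> {}" by simp
  from continuous_attains_sup[OF compact_sphere this cont]
  obtain x where x: "norm x = 1" and max: "\<And>y. norm y = 1 \<Longrightarrow> y \<bullet> (A *v y) \<le> x \<bullet> (A *v x)"
    by auto
  define c where "c = x \<bullet> (A *v x)"
  have bound: "y \<bullet> (A *v y) \<le> c * (y \<bullet> y)" for y
  proof (cases "y = 0")
    case False
    then have "norm (y /\<^sub>R norm y) = 1" by simp
    from max[OF this] have "(y \<bullet> (A *v y)) / (norm y)\<^sup>2 \<le> c"
      by (simp add: matrix_vector_mult_scaleR c_def divide_inverse power2_eq_square mult_ac)
    then show ?thesis
      using False by (simp add: power2_norm_eq_inner pos_divide_le_eq)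
  qed simp
  have "(mat c - A) *v x = 0"
  proof (rule positive_semidefinite_null[OF transpose_mat_diff[OF sym]])
    show "y \<bullet> ((mat c - A) *v y) \<ge> 0" for y
      using bound by (simp add: mat_diff_vector_mult inner_diff_right)
    show "x \<bullet> ((mat c - A) *v x) = 0"
      using x by (simp add: mat_diff_vector_mult inner_diff_right c_def norm_eq_1)
  qed
  then have "A *v x = c *\<^sub>R x" by (simp add: mat_diff_vector_mult)
  moreover have "x \<noteq> 0" using x by auto
  ultimately show thesis
    using that bound by (auto simp: eigenvalues_def)
qed

lemma min_eigenvalue:
  fixes A :: "real^'v::finite^'v"
  assumes sym: "transpose A = A"
  obtains c where "c \<in> eigenvalues A" "\<And>y. y \<bullet> (A *v y) \<ge> c * (y \<bullet> y)"
proof -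
  have neg: "(- A) *v x = - (A *v x)" for x
    using mat_diff_vector_mult[of 0 A x] by simp
  have "transpose (- A) = - A"
    using transpose_mat_diff[OF sym, of 0] by simp
  then obtain c where c: "c \<in> eigenvalues (- A)" "\<And>y. y \<bullet> ((- A) *v y) \<le> c * (y \<bullet> y)"
    using max_eigenvalue by blast
  have "- c \<in> eigenvalues A"
    using c(1) by (force simp: eigenvalues_def neg minus_equation_iff[of "A *v _"])
  moreover have "y \<bullet> (A *v y) \<ge> - c * (y \<bullet> y)" for y
    using c(2)[of y] by (simp add: neg)
  ultimately show thesis
    using that by blast
qed

lemma num_eigenvalues_ge_2:
  fixes A :: "real^'v::finite^'v"
  assumes sym: "transpose A = A" and ij: "i \<noteq> j" "A $ i $ j \<noteq> 0"
  shows "num_eigenvalues A \<ge> 2"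
proof (rule ccontr)
  assume "\<not> ?thesis"
  then have "card (eigenvalues A) \<le> Suc 0"
    by (simp add: num_eigenvalues_def)
  then have uniq: "\<And>a b. a \<in> eigenvalues A \<Longrightarrow> b \<in> eigenvalues A \<Longrightarrow> a = b"
    using card_le_Suc0_iff_eq[OF finite_eigenvalues[OF sym]] by blast
  obtain c where c: "c \<in> eigenvalues A" "\<And>y. y \<bullet> (A *v y) \<le> c * (y \<bullet> y)"
    using max_eigenvalue[OF sym] by blast
  obtain d where d: "d \<in> eigenvalues A" "\<And>y. y \<bullet> (A *v y) \<ge> d * (y \<bullet> y)"
    using min_eigenvalue[OF sym] by blast
  have "d = c" using uniq c d by blast
  then have eq: "y \<bullet> (A *v y) = c * (y \<bullet> y)" for y
    using c(2)[of y] d(2)[of y] by simp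
  \<comment> \<open>The form of \<open>mat c - A\<close> vanishes identically, so every vector is in
    its kernel; entry i of the image of the j-th unit vector then contradicts
    \<open>A $ i $ j \<noteq> 0\<close>.\<close>
  have "(mat c - A) *v axis j 1 = 0"
    by (rule positive_semidefinite_null[OF transpose_mat_diff[OF sym]])
       (simp_all add: mat_diff_vector_mult inner_diff_right eq)
  then have "A *v axis j 1 = c *\<^sub>R axis j 1"
    by (simp add: mat_diff_vector_mult)
  then have "(A *v axis j 1) $ i = (c *\<^sub>R axis j 1) $ i" by simp
  moreover have "axis j (1 :: real) $ i = 0"
    using ij by (simp add: axis_def)
  ultimately show False
    using ij by (simp add: matrix_vector_mult_basis column_def)
qed

section \<open>Lower bound on multiplicities from independent sets\<close>

lemma subspace_eigenspace: "subspace (eigenspace A c)"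
  by (auto simp: subspace_def eigenspace_def matrix_vector_right_distrib
      matrix_vector_mult_scaleR scaleR_add_right)

text \<open>Diagonalisability is read off from the multiplicities: the two eigenspaces meet only in
  0, so dimensions adding up to n make their sum the whole space.\<close>

lemma eigenspaces_span:
  fixes A :: "real^'v::finite^'v"
  assumes ab: "a \<noteq> b" and dims: "eig_mult A a + eig_mult A b = CARD('v)"
  obtains y z where "y \<in> eigenspace A a" "z \<in> eigenspace A b" "x = y + z"
proof -
  let ?S = "eigenspace A a" and ?T = "eigenspace A b"
  let ?U = "{y + z |y z. y \<in> ?S \<and> z \<in> ?T}"
  have "?S \<inter> ?T \<subseteq> {0}"
    using ab by (auto simp: eigenspace_def)
  then have "dim (?S \<inter> ?T) = 0"
    by (simp add: dim_eq_0)
  then have "dim ?U = CARD('v)"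
    using dim_sums_Int[OF subspace_eigenspace[of A a] subspace_eigenspace[of A b]] dims
    unfolding eig_mult_def by linarith
  then have "dim ?U = DIM(real^'v)"
    by simp
  moreover have "subspace ?U"
    by (intro subspace_sums subspace_eigenspace)
  ultimately have "?U = UNIV"
    by (simp only: dim_eq_full span_eq_iff[THEN iffD2])
  then show thesis
    using that by blast
qed

lemma independent_set_card_le_eig_mult:
  fixes A :: "real^'v::finite^'v"
  assumes sym: "transpose A = A" and ab: "a \<noteq> b"
    and dims: "eig_mult A a + eig_mult A b = CARD('v)"
    and indep: "\<And>u v. u \<in> X \<Longrightarrow> v \<in> X \<Longrightarrow> u \<noteq> v \<Longrightarrow> A $ u $ v = 0"
    and nonisolated: "\<And>v. v \<in> X \<Longrightarrow> \<exists>u. u \<noteq> v \<and> A $ u $ v \<noteq> 0"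
  shows "card X \<le> eig_mult A b"
proof -
  \<comment> \<open>Column v of A - a.\<close>
  define f where "f v = A *v axis v 1 - a *\<^sub>R axis v 1" for v
  have f_nth: "f v $ u = A $ u $ v - (if u = v then a else 0)" for u v
  proof -
    have "axis v (1 :: real) $ u = (if u = v then 1 else 0)"
      by (simp add: axis_def)
    then show ?thesis
      by (simp add: f_def matrix_vector_mult_basis column_def)
  qed
  have f_eig: "A *v f v = b *\<^sub>R f v" for v
  proof -
    obtain y z where y: "A *v y = a *\<^sub>R y" and z: "A *v z = b *\<^sub>R z" and yz: "axis v 1 = y + z"
      using eigenspaces_span[OF ab dims] unfolding eigenspace_def by blast
    \<comment> \<open>A - a kills the component in the a-eigenspace and scales the other one by b -
      a.\<close>
    have "f v = (b - a) *\<^sub>R z"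
      unfolding f_def yz by (simp add: matrix_vector_right_distrib y z algebra_simps)
    then show ?thesis
      by (simp add: matrix_vector_mult_scaleR z)
  qed
  have inner_f: "f u \<bullet> f v = (b - a) * (f v $ u)" for u v
  proof -
    \<comment> \<open>Moving the symmetric A - a from the left factor to \<open>f v\<close>, where
      it acts as b - a, leaves a single entry of A - a.\<close>
    have "f u \<bullet> f v = axis u 1 \<bullet> (A *v f v) - a * (axis u 1 \<bullet> f v)"
      using inner_symmetric_matrix[OF sym, of "axis u 1" "f v"]
      by (simp add: f_def[of u] inner_diff_left)
    then show ?thesis
      by (simp add: f_eig inner_axis' algebra_simps)
  qed
  have nz: "f v \<noteq> 0" if "v \<in> X" for v
  proof -
    obtain u where "u \<noteq> v" "A $ u $ v \<noteq> 0" using nonisolated \<open>v \<in> X\<close> by blast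
    \<comment> \<open>Subtracting a changes only the diagonal, so the entry at a neighbour
      survives.\<close>
    then have "f v $ u \<noteq> 0" by (simp add: f_nth)
    then show ?thesis by auto
  qed
  have orth: "f u \<bullet> f v = 0" if "u \<in> X" "v \<in> X" "u \<noteq> v" for u v
    using that by (simp add: inner_f f_nth indep)
  have inj: "inj_on f X"
    using orth nz by (metis inj_onI inner_eq_zero_iff)
  have "independent (f ` X)"
    using nz orth by (intro pairwise_orthogonal_independent)
      (auto simp: pairwise_def orthogonal_def)
  moreover have "f ` X \<subseteq> eigenspace A b"
    using f_eig by (auto simp: eigenspace_def)
  ultimately show ?thesis
    unfolding eig_mult_def using independent_card_le_dim card_image[OF inj] by metis
qed

section \<open>Two-eigenvalue matrices from Gram matrices\<close>

text \<open>With W the n by k matrix of labels \<open>w\<close>, the hypothesis on columns says that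
  W^T W is c times the identity, so W W^T is c times the orthogonal projection onto the column space
  of W. Its kernel is the orthogonal complement, of dimension n - k.\<close>

lemma achieves_bipartition_orthogonal_columns:
  fixes G :: "'v::finite graph" and w :: "'v \<Rightarrow> nat \<Rightarrow> real"
  assumes k: "1 \<le> k" "k \<le> CARD('v) div 2" and c: "c \<noteq> 0"
    and cols: "\<And>i j. i < k \<Longrightarrow> j < k \<Longrightarrow> (\<Sum>v\<in>UNIV. w v i * w v j) = (if i = j then c else 0)"
    and adj: "\<And>u v. u \<noteq> v \<Longrightarrow> (\<Sum>i<k. w u i * w v i) \<noteq> 0 \<longleftrightarrow> G u v"
  shows "achieves_bipartition G k"
proof -
  define e :: "nat \<Rightarrow> real^'v" where "e i = (\<chi> v. w v i)" for i
  define A :: "real^'v^'v" where "A = (\<chi> u v. \<Sum>i<k. w u i * w v i)"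
  have inner_e: "e i \<bullet> e j = (if i = j then c else 0)" if "i < k" "j < k" for i j
    using cols[OF that] by (simp add: e_def inner_vec_def)
  have A_mult: "A *v x = (\<Sum>i<k. (e i \<bullet> x) *\<^sub>R e i)" for x
  proof -
    have "(A *v x) $ u = (\<Sum>v\<in>UNIV. \<Sum>i<k. w v i * x $ v * w u i)" for u
      by (simp add: A_def matrix_vector_mult_def sum_distrib_left mult_ac)
    then have "(A *v x) $ u = (\<Sum>i<k. \<Sum>v\<in>UNIV. w v i * x $ v * w u i)" for u
      by (subst sum.swap) simp
    then show ?thesis
      by (simp add: vec_eq_iff e_def inner_vec_def sum_distrib_right)
  qed
  have A_e: "A *v e j = c *\<^sub>R e j" if "j < k" for j
  proof -
    have "A *v e j = (\<Sum>i<k. if i = j then c *\<^sub>R e j else 0)"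
      unfolding A_mult using that by (intro sum.cong) (auto simp: inner_e)
    then show ?thesis using that by simp
  qed
  have e_nz: "e i \<noteq> 0" if "i < k" for i
    using inner_e[OF that that] c by auto
  let ?E = "e ` {..<k}"
  have indep: "independent ?E"
    using e_nz inner_e by (intro pairwise_orthogonal_independent)
      (auto simp: pairwise_def orthogonal_def)
  have "inj_on e {..<k}"
    using inner_e c by (metis inj_onI lessThan_iff)
  then have dim_E: "dim ?E = k"
    using dim_eq_card_independent[OF indep] by (simp add: card_image)
  have eig_c: "eigenspace A c = span ?E"
  proof
    show "eigenspace A c \<subseteq> span ?E"
    proof
      fix x assume "x \<in> eigenspace A c"
      then have "x = (1 / c) *\<^sub>R (\<Sum>i<k. (e i \<bullet> x) *\<^sub>R e i)"
        using c by (simp add: eigenspace_def flip: A_mult)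
      also have "\<dots> \<in> span ?E"
        by (intro span_scale span_sum span_base) auto
      finally show "x \<in> span ?E" .
    qed
    show "span ?E \<subseteq> eigenspace A c"
      by (intro span_minimal subspace_eigenspace) (auto simp: eigenspace_def A_e)
  qed
  have eig_0: "eigenspace A 0 = {x \<in> UNIV. \<forall>y\<in>span ?E. orthogonal y x}"
  proof (intro set_eqI iffI)
    fix x assume x: "x \<in> eigenspace A 0"
    have sym: "x \<bullet> (A *v y) = (A *v x) \<bullet> y" for y
      by (simp add: A_mult inner_sum_left inner_sum_right mult_ac inner_commute)
    \<comment> \<open>Eigenvectors of a symmetric matrix for the distinct eigenvalues 0 and c are
      orthogonal.\<close>
    have "orthogonal y x" if "y \<in> eigenspace A c" for y
      using sym[of y] x that c by (simp add: eigenspace_def orthogonal_def inner_commute)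
    then show "x \<in> {x \<in> UNIV. \<forall>y\<in>span ?E. orthogonal y x}"
      using eig_c by simp
  next
    fix x assume "x \<in> {x \<in> UNIV. \<forall>y\<in>span ?E. orthogonal y x}"
    then have "e i \<bullet> x = 0" if "i < k" for i
      using that by (auto simp: orthogonal_def span_base)
    then show "x \<in> eigenspace A 0"
      by (simp add: eigenspace_def A_mult)
  qed
  have mult_c: "eig_mult A c = k"
    by (simp add: eig_mult_def eig_c dim_E)
  have mult_0: "eig_mult A 0 = CARD('v) - k"
    using dim_subspace_orthogonal_to_vectors[of "span ?E" "UNIV :: (real^'v) set"]
    by (simp add: eig_mult_def eig_0 dim_E)
  have mem: "a \<in> eigenvalues A" if "eig_mult A a \<noteq> 0" for a
  proof -
    have "\<not> eigenspace A a \<subseteq> {0}"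
      using that by (simp add: eig_mult_def dim_eq_0)
    then show ?thesis
      by (auto simp: eigenspace_def eigenvalues_def)
  qed
  have "eigenvalues A = {0, c}"
  proof
    \<comment> \<open>Both multiplicities are positive because \<open>k\<close> is at least 1 and at
      most half of n.\<close>
    have "eig_mult A 0 \<noteq> 0" "eig_mult A c \<noteq> 0"
      using k mult_0 mult_c by auto
    then show "{0, c} \<subseteq> eigenvalues A"
      using mem by blast
    show "eigenvalues A \<subseteq> {0, c}"
    proof
      fix a assume "a \<in> eigenvalues A"
      then obtain x where x: "x \<noteq> 0" "A *v x = a *\<^sub>R x"
        by (auto simp: eigenvalues_def)
      \<comment> \<open>The image of A is its c-eigenspace, so an eigenvalue a satisfies a * a = c *
        a.\<close>
      have "A *v x \<in> eigenspace A c"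
        unfolding eig_c by (subst A_mult) (intro span_scale span_sum span_base, auto)
      then have "a *\<^sub>R (a *\<^sub>R x) = c *\<^sub>R (a *\<^sub>R x)"
        by (simp add: eigenspace_def x matrix_vector_mult_scaleR)
      then show "a \<in> {0, c}"
        using x by auto
    qed
  qed
  moreover have "A \<in> graph_matrices G"
    using adj by (simp add: graph_matrices_def A_def transpose_def mult.commute)
  ultimately show ?thesis
    unfolding achieves_bipartition_def using k mult_0 mult_c c by metis
qed

section \<open>Labelling the parts, and the values of q and MB\<close>

theorem corollary3p5:
  fixes H :: "'v::finite graph" and P :: "'v set set" and k :: nat
  assumes "k \<ge> 2"
    and "simple_graph H"
    and "complete_multipartite H P"
    and "card P \<ge> 2"
    and "\<forall>X\<in>P. card X = k"
  shows "q_graph H = 2 \<and> MB H = k"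
proof -
  have partition: "partition_on UNIV P"
    and adj: "\<And>u v. H u v \<longleftrightarrow> \<not> (\<exists>X\<in>P. u \<in> X \<and> v \<in> X)"
    using assms(3) by (simp_all add: complete_multipartite_def)
  have cover: "\<Union>P = UNIV" and disj: "\<And>X Y. X \<in> P \<Longrightarrow> Y \<in> P \<Longrightarrow> X \<noteq> Y \<Longrightarrow> X \<inter> Y = {}"
    using partition by (auto simp: partition_on_def disjoint_def)
  have finP: "finite P" by simp
  have sum_parts: "(\<Sum>v\<in>UNIV. g v) = (\<Sum>X\<in>P. \<Sum>v\<in>X. g v)" for g :: "'v \<Rightarrow> real"
    using sum.Union_disjoint[of P g] disj cover by simp
  have "CARD('v) = k * card P"
    using card_partition[of P k] cover disj assms(5) by simp
  then have k: "1 \<le> k" "k \<le> CARD('v) div 2"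
    using assms(1,4) by (auto simp: less_eq_div_iff_mult_less_eq)
  have "\<exists>X. X \<in> P \<and> v \<in> X" for v
    using cover by (metis UNIV_I UnionE)
  then obtain part where part: "\<And>v. part v \<in> P" "\<And>v. v \<in> part v"
    by metis
  have part_eq: "part v = X" if "X \<in> P" "v \<in> X" for v X
    using disj[OF part(1)[of v] that(1)] part(2)[of v] that(2) by blast
  have H_iff: "H u v \<longleftrightarrow> part u \<noteq> part v" for u v
    using adj part part_eq by metis
  have "\<exists>h. bij_betw h X {..<k}" if "X \<in> P" for X
    using ex_bij_betw_finite_nat[of X] assms(5) that by (auto simp: lessThan_atLeast0)
  then obtain h where h: "\<And>X. X \<in> P \<Longrightarrow> bij_betw (h X) X {..<k}"
    by metis
  define ix where "ix v = h (part v) v" for v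
  have ix_less: "ix v < k" for v
    using bij_betw_apply[OF h] part by (auto simp: ix_def)
  have ix_inj: "ix u \<noteq> ix v" if "part u = part v" "u \<noteq> v" for u v
    using h[OF part(1)[of u]] part(2) that unfolding bij_betw_def inj_on_def ix_def by metis
  obtain Q :: "'v set \<Rightarrow> nat \<Rightarrow> nat \<Rightarrow> real" where
    Q_sym: "\<forall>x\<in>P. \<forall>i j. Q x i j = Q x j i" and
    Q_orth: "\<forall>x\<in>P. \<forall>i<k. \<forall>j<k. (\<Sum>l<k. Q x i l * Q x j l) = (if i = j then 1 else 0)" and
    Q_nz: "\<forall>x\<in>P. \<forall>y\<in>P. x \<noteq> y \<longrightarrow> (\<forall>i<k. \<forall>j<k. (\<Sum>l<k. Q x i l * Q y j l) \<noteq> 0)"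
    using orthogonal_family_nowhere_zero_products[OF assms(1) finP]
    by (elim exE conjE) (rule that)
  note Q_sym = Q_sym[rule_format] and Q_orth = Q_orth[rule_format] and Q_nz = Q_nz[rule_format]
  \<comment> \<open>The vertices of a part use each row of the matrix of that part exactly
    once.\<close>
  define w where "w v = Q (part v) (ix v)" for v
  have ach: "achieves_bipartition H k"
  \<comment> \<open>Each part contributes an identity matrix to W^T W, so the non-zero eigenvalue is
    the number of parts.\<close>
  proof (rule achieves_bipartition_orthogonal_columns[OF k, of "real (card P)" w])
    show "real (card P) \<noteq> 0" using assms(4) by linarith
    show "(\<Sum>v\<in>UNIV. w v i * w v j) = (if i = j then real (card P) else 0)" if "i < k" "j < k" for i j
    proof -
      have "(\<Sum>v\<in>X. w v i * w v j) = (if i = j then 1 else 0)" if X: "X \<in> P" for X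
      proof -
        \<comment> \<open>Symmetry of \<open>Q X\<close> exchanges the roles of rows and columns, so
          orthonormality of rows applies to this product of columns.\<close>
        have "(\<Sum>v\<in>X. w v i * w v j) = (\<Sum>v\<in>X. Q X i (h X v) * Q X j (h X v))"
          using X by (intro sum.cong) (auto simp: w_def ix_def part_eq Q_sym[OF X, of _ i] Q_sym[OF X, of _ j])
        also have "\<dots> = (\<Sum>l<k. Q X i l * Q X j l)"
          using sum.reindex_bij_betw[OF h[OF X]] .
        finally show ?thesis
          using Q_orth[OF X] \<open>i < k\<close> \<open>j < k\<close> by simp
      qed
      then show ?thesis
        by (simp add: sum_parts)
    qed
    show "(\<Sum>i<k. w u i * w v i) \<noteq> 0 \<longleftrightarrow> H u v" if "u \<noteq> v" for u v
    proof (cases "part u = part v")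
      case True
      then show ?thesis
        using Q_orth[OF part(1)[of u] ix_less[of u] ix_less[of v]] ix_inj[OF True that] H_iff
        by (simp add: w_def)
    next
      case False
      then show ?thesis
        using Q_nz[OF part(1) part(1) False ix_less ix_less] H_iff by (simp add: w_def)
    qed
  qed
  have neighbour: "\<exists>u. H u v" for v
  proof -
    \<comment> \<open>With at least two parts, a vertex of any other part is adjacent to
      \<open>v\<close>; that part is non-empty as it has \<open>k\<close> elements.\<close>
    have "\<not> P \<subseteq> {part v}"
      using assms(4) card_mono[of "{part v}" P] by auto
    then obtain X where X: "X \<in> P" "X \<noteq> part v" by blast
    then obtain u where "u \<in> X"
      using assms(1,5) by fastforce
    then show ?thesis
      using H_iff part_eq X by metis
  qed
  have H_irrefl: "\<not> H v v" for v
    by (simp add: H_iff)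
  have "MB H = k"
    unfolding MB_def
  proof (rule Least_equality)
    show "achieves_bipartition H k" by (rule ach)
    fix j assume "achieves_bipartition H j"
    then obtain A a b where A: "A \<in> graph_matrices H" "a \<noteq> b" "j \<le> CARD('v) div 2"
      "eig_mult A a = CARD('v) - j" "eig_mult A b = j"
      by (auto simp: achieves_bipartition_def)
    obtain X where X: "X \<in> P" using assms(4) by fastforce
    have "card X \<le> eig_mult A b"
    proof (rule independent_set_card_le_eig_mult[of A a b X])
      \<comment> \<open>The bound \<open>j \<le> CARD('v) div 2\<close> makes the subtraction of
        naturals exact.\<close>
      show "eig_mult A a + eig_mult A b = CARD('v)" using A by simp
      show "A $ u $ v = 0" if "u \<in> X" "v \<in> X" "u \<noteq> v" for u v
        using A(1) adj X that unfolding graph_matrices_def by blast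
      show "\<exists>u. u \<noteq> v \<and> A $ u $ v \<noteq> 0" for v
      proof -
        obtain u where "H u v" using neighbour by blast
        then have "u \<noteq> v" using H_irrefl by blast
        then show ?thesis
          using \<open>H u v\<close> A(1) by (auto simp: graph_matrices_def)
      qed
    qed (use A in \<open>auto simp: graph_matrices_def\<close>)
    then show "k \<le> j"
      using A assms(5) X by simp
  qed
  moreover have "q_graph H = 2"
    unfolding q_graph_def
  proof (rule Least_equality)
    show "\<exists>A\<in>graph_matrices H. num_eigenvalues A = 2"
      using ach unfolding achieves_bipartition_def num_eigenvalues_def by (metis card_2_iff)
    fix m assume "\<exists>A\<in>graph_matrices H. num_eigenvalues A = m"
    then obtain A where A: "A \<in> graph_matrices H" "num_eigenvalues A = m" by blast
    obtain u v where "H u v" using neighbour by blast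
    then have "u \<noteq> v" using H_irrefl by blast
    then have "A $ u $ v \<noteq> 0"
      using \<open>H u v\<close> A(1) by (simp add: graph_matrices_def)
    then show "2 \<le> m"
      using num_eigenvalues_ge_2[of A u v] A \<open>u \<noteq> v\<close> by (auto simp: graph_matrices_def)
  qed
  ultimately show ?thesis by simp
qed

end
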